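(* Let $X$ be a finite set of cardinality $n$ and let $(X,S)$ be a non-degenerate symmetric set-theoretical solution of the quantum Yang-Baxter equation that verifies Property $(\mathcal{C})$. Then: (1) the group $W(X,S)$ has the group presentation $$\left\langle\ \mathbf{X}\ \left|\ \begin{array}{lcl}\psi_x\psi_y=\psi_z\psi_t&;&x,y\in X,\ S(x,y)=(z,t)\neq(x,y)\\ \psi_x\psi_y=1&;&x,y\in X,\ S(x,y)=(x,y)\end{array}\right.\right\rangle;$$ (2) $W(X,S)$ is a finite group of order $2^n$.
   Context: Let $X$ be a finite set and $S:X\times X\to X\times X$ a bijection; write $S(x,y)=(g_x(y),f_y(x))$ with $g_x,f_y:X\to X$. $(X,S)$ is non-degenerate if all $f_x,g_x$ are bijections; it is symmetric if it is involutive ($S\circ S=\mathrm{Id}$) and braided ($S^{12}S^{23}S^{12}=S^{23}S^{12}S^{23}$ on $X^3$). The structure group $G(X,S)$ has the group presentation $\langle X\mid xy=g_x(y)f_y(x);\ x,y\in X,\ S(x,y)\ne(x,y)\rangle$. A pair $(x,y)\in X\times X$ is frozen if $S(x,y)=(x,y)$. $(X,S)$ verifies Property $(\mathcal{C})$ if for every frozen pair $(x,y)$ one has $g_x\circ g_y=\mathrm{Id}_X$ and $f_y\circ f_x=\mathrm{Id}_X$. Let $V$ be the real vector space with basis $X$ and $\phi_x=f_x^{-1}$. For $x\in X$, $\psi_x\in GL(V)$ is the linear map with $\psi_x(y)=\phi_x(y)$ for $y\in X$, $y\ne x$, and $\psi_x(x)=-\phi_x(x)$. The map $x\mapsto\psi_x$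 extends to a group morphism $\psi:G(X,S)\to GL(V)$; $W(X,S)=\psi(G(X,S))$ and $\mathbf{X}=\{\psi_x\mid x\in X\}$. *)

theory Defs
  imports "HOL-Algebra.Coset" "HOL-Algebra.Bij" "HOL-Analysis.Finite_Function_Topology"
begin

section \<open>Free groups and group presentations\<close>

text \<open>A letter \<open>(a, True)\<close> stands for the generator \<open>a\<close>, and \<open>(a, False)\<close> for its formal inverse.
  Elements of the free group are freely reduced words.\<close>

type_synonym 'a word = "('a \<times> bool) list"

definition letter_inv :: "'a \<times> bool \<Rightarrow> 'a \<times> bool" where
  "letter_inv l = (fst l, \<not> snd l)"

definition reduced :: "'a word \<Rightarrow> bool" where
  "reduced w \<longleftrightarrow> successively (\<lambda>l m. m \<noteq> letter_inv l) w"

fun push_letter :: "'a \<times> bool \<Rightarrow> 'a word \<Rightarrow> 'a word" where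
  "push_letter l [] = [l]"
| "push_letter l (m # w) = (if m = letter_inv l then w else l # m # w)"

definition reduce :: "'a word \<Rightarrow> 'a word" where
  "reduce w = foldr push_letter w []"

definition free_group :: "'a set \<Rightarrow> 'a word monoid" where
  "free_group A = \<lparr>carrier = {w \<in> lists (A \<times> UNIV). reduced w},
                   mult = \<lambda>u v. reduce (u @ v),
                   one = []\<rparr>"

definition free_gen :: "'a \<Rightarrow> 'a word" where
  "free_gen a = [(a, True)]"

definition normal_closure :: "('g, 'm) monoid_scheme \<Rightarrow> 'g set \<Rightarrow> 'g set" where
  "normal_closure G R = \<Inter> {N. N \<lhd> G \<and> R \<subseteq> N}"

text \<open>A set of relations is a set of pairs \<open>(u, v)\<close> of elements of the free group, read as \<open>u = v\<close>.\<close>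

definition relators :: "'a set \<Rightarrow> ('a word \<times> 'a word) set \<Rightarrow> 'a word set" where
  "relators A R = {u \<otimes>\<^bsub>free_group A\<^esub> inv\<^bsub>free_group A\<^esub> v | u v. (u, v) \<in> R}"

definition presented_group :: "'a set \<Rightarrow> ('a word \<times> 'a word) set \<Rightarrow> 'a word set monoid" where
  "presented_group A R = free_group A Mod normal_closure (free_group A) (relators A R)"

definition pres_gen :: "'a set \<Rightarrow> ('a word \<times> 'a word) set \<Rightarrow> 'a \<Rightarrow> 'a word set" where
  "pres_gen A R a = normal_closure (free_group A) (relators A R) #>\<^bsub>free_group A\<^esub> free_gen a"

text \<open>\<open>H\<close> has the presentation \<open>\<langle>A | R\<rangle>\<close>, where the generating set \<open>A\<close> consists of elements of \<open>H\<close>.\<close>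

definition has_presentation ::
  "('h, 'm) monoid_scheme \<Rightarrow> 'h set \<Rightarrow> ('h word \<times> 'h word) set \<Rightarrow> bool" where
  "has_presentation H A R \<longleftrightarrow> group H \<and> A \<subseteq> carrier H \<and>
     (\<exists>h \<in> iso (presented_group A R) H. \<forall>a\<in>A. h (pres_gen A R a) = a)"


section \<open>Set-theoretical solutions\<close>

definition sol_g :: "('a \<times> 'a \<Rightarrow> 'a \<times> 'a) \<Rightarrow> 'a \<Rightarrow> 'a \<Rightarrow> 'a" where
  "sol_g S x y = fst (S (x, y))"

definition sol_f :: "('a \<times> 'a \<Rightarrow> 'a \<times> 'a) \<Rightarrow> 'a \<Rightarrow> 'a \<Rightarrow> 'a" where
  "sol_f S y x = snd (S (x, y))"

definition nondegenerate :: "'a set \<Rightarrow> ('a \<times> 'a \<Rightarrow> 'a \<times> 'a) \<Rightarrow> bool" where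
  "nondegenerate X S \<longleftrightarrow> (\<forall>x\<in>X. bij_betw (sol_f S x) X X \<and> bij_betw (sol_g S x) X X)"

definition involutive :: "'a set \<Rightarrow> ('a \<times> 'a \<Rightarrow> 'a \<times> 'a) \<Rightarrow> bool" where
  "involutive X S \<longleftrightarrow> (\<forall>p \<in> X \<times> X. S (S p) = p)"

definition S12 :: "('a \<times> 'a \<Rightarrow> 'a \<times> 'a) \<Rightarrow> 'a \<times> 'a \<times> 'a \<Rightarrow> 'a \<times> 'a \<times> 'a" where
  "S12 S = (\<lambda>(x, y, z). let (u, v) = S (x, y) in (u, v, z))"

definition S23 :: "('a \<times> 'a \<Rightarrow> 'a \<times> 'a) \<Rightarrow> 'a \<times> 'a \<times> 'a \<Rightarrow> 'a \<times> 'a \<times> 'a" where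
  "S23 S = (\<lambda>(x, y, z). let (u, v) = S (y, z) in (x, u, v))"

definition braided :: "'a set \<Rightarrow> ('a \<times> 'a \<Rightarrow> 'a \<times> 'a) \<Rightarrow> bool" where
  "braided X S \<longleftrightarrow>
     (\<forall>p \<in> X \<times> X \<times> X. S12 S (S23 S (S12 S p)) = S23 S (S12 S (S23 S p)))"

definition nondegenerate_symmetric_solution :: "'a set \<Rightarrow> ('a \<times> 'a \<Rightarrow> 'a \<times> 'a) \<Rightarrow> bool" where
  "nondegenerate_symmetric_solution X S \<longleftrightarrow>
     bij_betw S (X \<times> X) (X \<times> X) \<and> nondegenerate X S \<and> involutive X S \<and> braided X S"

definition property_C :: "'a set \<Rightarrow> ('a \<times> 'a \<Rightarrow> 'a \<times> 'a) \<Rightarrow> bool" where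
  "property_C X S \<longleftrightarrow>
     (\<forall>x\<in>X. \<forall>y\<in>X. S (x, y) = (x, y) \<longrightarrow>
        (\<forall>z\<in>X. sol_g S x (sol_g S y z) = z \<and> sol_f S y (sol_f S x z) = z))"

definition structure_relations ::
  "'a set \<Rightarrow> ('a \<times> 'a \<Rightarrow> 'a \<times> 'a) \<Rightarrow> ('a word \<times> 'a word) set" where
  "structure_relations X S =
     {(free_gen x \<otimes>\<^bsub>free_group X\<^esub> free_gen y,
       free_gen (sol_g S x y) \<otimes>\<^bsub>free_group X\<^esub> free_gen (sol_f S y x)) | x y.
      x \<in> X \<and> y \<in> X \<and> S (x, y) \<noteq> (x, y)}"

definition structure_group :: "'a set \<Rightarrow> ('a \<times> 'a \<Rightarrow> 'a \<times> 'a) \<Rightarrow> 'a word set monoid" where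
  "structure_group X S = presented_group X (structure_relations X S)"


section \<open>The linear representation\<close>

text \<open>The free real vector space on a set \<open>X\<close> is realised inside the finitely supported functions
  by its basis of point masses. As in \<^const>\<open>BijGroup\<close>, its linear automorphisms are extensional
  functions.\<close>

definition basis_vec :: "'a \<Rightarrow> 'a \<Rightarrow>\<^sub>0 real" where
  "basis_vec x = Poly_Mapping.single x 1"

definition free_space :: "'a set \<Rightarrow> ('a \<Rightarrow>\<^sub>0 real) set" where
  "free_space X = span (basis_vec ` X)"

definition GL :: "'v::real_vector set \<Rightarrow> ('v \<Rightarrow> 'v) monoid" where
  "GL V = (BijGroup V)\<lparr>carrier :=
     {T \<in> Bij V. (\<forall>u\<in>V. \<forall>v\<in>V. T (u + v) = T u + T v) \<and> (\<forall>c. \<forall>v\<in>V. T (c *\<^sub>R v) = c *\<^sub>R T v)}\<rparr>"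

definition sol_phi :: "'a set \<Rightarrow> ('a \<times> 'a \<Rightarrow> 'a \<times> 'a) \<Rightarrow> 'a \<Rightarrow> 'a \<Rightarrow> 'a" where
  "sol_phi X S x = inv_into X (sol_f S x)"

definition sol_psi ::
  "'a set \<Rightarrow> ('a \<times> 'a \<Rightarrow> 'a \<times> 'a) \<Rightarrow> 'a \<Rightarrow> ('a \<Rightarrow>\<^sub>0 real) \<Rightarrow> ('a \<Rightarrow>\<^sub>0 real)" where
  "sol_psi X S x = (\<lambda>v \<in> free_space X.
     \<Sum>y\<in>X. Poly_Mapping.lookup v y *\<^sub>R
       (if y = x then - basis_vec (sol_phi X S x y) else basis_vec (sol_phi X S x y)))"

text \<open>The morphism is determined on the carrier of the structure group by its values on the
  generators; its existence is lemma \<open>structure_rep\<close> below.\<close>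

definition structure_rep ::
  "'a set \<Rightarrow> ('a \<times> 'a \<Rightarrow> 'a \<times> 'a) \<Rightarrow> 'a word set \<Rightarrow> ('a \<Rightarrow>\<^sub>0 real) \<Rightarrow> ('a \<Rightarrow>\<^sub>0 real)" where
  "structure_rep X S = (SOME h. h \<in> hom (structure_group X S) (GL (free_space X)) \<and>
     (\<forall>x\<in>X. h (pres_gen X (structure_relations X S) x) = sol_psi X S x))"

definition W_group ::
  "'a set \<Rightarrow> ('a \<times> 'a \<Rightarrow> 'a \<times> 'a) \<Rightarrow> (('a \<Rightarrow>\<^sub>0 real) \<Rightarrow> ('a \<Rightarrow>\<^sub>0 real)) monoid" where
  "W_group X S = (GL (free_space X))\<lparr>carrier := structure_rep X S ` carrier (structure_group X S)\<rparr>"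


section \<open>Free groups are groups; universal properties\<close>

lemma letter_inv_invol [simp]: "letter_inv (letter_inv l) = l"
  by (simp add: letter_inv_def)

lemma reduced_push: "reduced w \<Longrightarrow> reduced (push_letter l w)"
  by (cases w) (auto simp: reduced_def successively_Cons)

lemma reduced_foldr: "reduced r \<Longrightarrow> reduced (foldr push_letter w r)"
  by (induction w) (auto intro: reduced_push)

lemma reduced_Nil [simp]: "reduced []"
  by (simp add: reduced_def)

lemma reduced_reduce: "reduced (reduce w)"
  by (simp add: reduce_def reduced_foldr)

lemma reduced_ConsD: "reduced (l # w) \<Longrightarrow> reduced w"
  by (cases w) (auto simp: reduced_def)

lemma push_reduced: "reduced (l # w) \<Longrightarrow> push_letter l w = l # w"
  by (cases w) (auto simp: reduced_def)

lemma reduce_reduced: "reduced w \<Longrightarrow> reduce w = w"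
proof (induction w)
  case (Cons l w)
  then have "reduce w = w" using reduced_ConsD by blast
  then show ?case using push_reduced[OF Cons.prems] by (simp add: reduce_def)
qed (simp add: reduce_def)

lemma push_push: "reduced r \<Longrightarrow> push_letter l (push_letter (letter_inv l) r) = r"
  by (cases r; cases "tl r") (auto simp: reduced_def)

lemma foldr_push: "reduced r \<Longrightarrow>
  foldr push_letter (push_letter l w) r = push_letter l (foldr push_letter w r)"
  by (cases w) (auto simp: push_push reduced_foldr)

lemma foldr_reduce: "reduced r \<Longrightarrow> foldr push_letter (reduce w) r = foldr push_letter w r"
  by (induction w) (auto simp: reduce_def foldr_push)

lemma reduce_append1: "reduce (reduce u @ v) = reduce (u @ v)"
  using foldr_reduce[of "reduce v" u] reduced_reduce[of v] by (simp add: reduce_def)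

lemma reduce_append2: "reduce (u @ reduce v) = reduce (u @ v)"
  using reduce_reduced[OF reduced_reduce, of v] by (simp add: reduce_def)

lemma push_lists: "l \<in> L \<Longrightarrow> w \<in> lists L \<Longrightarrow> push_letter l w \<in> lists L"
  by (cases w) auto

lemma reduce_lists: "w \<in> lists L \<Longrightarrow> reduce w \<in> lists L"
  unfolding reduce_def
  by (induction rule: lists.induct) (simp_all add: push_lists del: in_lists_conv_set)

lemma reduce_inv_word: "reduce (map letter_inv (rev w) @ w) = []"
proof (induction w)
  case (Cons l w)
  have "push_letter (letter_inv l) (push_letter l (reduce w)) = reduce w"
    using push_push[of "reduce w" "letter_inv l"] reduced_reduce[of w] by simp
  with Cons show ?case by (simp add: reduce_def)
qed (simp add: reduce_def)

lemma group_free_group: "group (free_group A)"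
proof (rule groupI)
  fix u assume "u \<in> carrier (free_group A)"
  then have u: "u \<in> lists (A \<times> UNIV)" "reduced u" by (auto simp: free_group_def)
  let ?v = "map letter_inv (rev u)"
  have "?v \<in> lists (A \<times> UNIV)" using u(1) by (fastforce simp: letter_inv_def)
  then have "reduce ?v \<in> carrier (free_group A)"
    by (simp only: free_group_def) (simp add: reduce_lists reduced_reduce del: in_lists_conv_set)
  moreover have "reduce ?v \<otimes>\<^bsub>free_group A\<^esub> u = \<one>\<^bsub>free_group A\<^esub>"
    by (simp add: free_group_def reduce_append1 reduce_inv_word)
  ultimately show "\<exists>v\<in>carrier (free_group A). v \<otimes>\<^bsub>free_group A\<^esub> u = \<one>\<^bsub>free_group A\<^esub>" by blast
next
  fix u v assume "u \<in> carrier (free_group A)" "v \<in> carrier (free_group A)"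
  then have "u @ v \<in> lists (A \<times> UNIV)" by (auto simp: free_group_def)
  then show "u \<otimes>\<^bsub>free_group A\<^esub> v \<in> carrier (free_group A)"
    by (simp add: free_group_def reduce_lists reduced_reduce del: in_lists_conv_set)
qed (simp_all add: free_group_def reduce_append1 reduce_append2 reduce_reduced)

lemma free_gen_carrier: "a \<in> A \<Longrightarrow> free_gen a \<in> carrier (free_group A)"
  by (simp add: free_gen_def free_group_def reduced_def)

lemma normal_normal_closure:
  assumes "group G" "R \<subseteq> carrier G"
  shows "normal_closure G R \<lhd> G"
proof -
  interpret group G by fact
  have ne: "carrier G \<in> {N. N \<lhd> G \<and> R \<subseteq> N}"
    using assms(2) by (auto simp: normal_inv_iff subgroup_self)
  have "subgroup (normal_closure G R) G"
    unfolding normal_closure_def using ne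
    by (intro subgroups_Inter) (auto dest: normal_imp_subgroup)
  then show ?thesis
    unfolding normal_inv_iff normal_closure_def by (auto simp: normal_inv_iff)
qed

lemma relators_carrier:
  assumes "R \<subseteq> carrier (free_group A) \<times> carrier (free_group A)"
  shows "relators A R \<subseteq> carrier (free_group A)"
proof -
  interpret group "free_group A" by (rule group_free_group)
  show ?thesis using assms by (force simp: relators_def)
qed

lemma group_presented_group:
  "R \<subseteq> carrier (free_group A) \<times> carrier (free_group A) \<Longrightarrow> group (presented_group A R)"
  unfolding presented_group_def
  by (intro normal.factorgroup_is_group normal_normal_closure group_free_group relators_carrier)

definition word_eval :: "('h, 'm) monoid_scheme \<Rightarrow> ('a \<Rightarrow> 'h) \<Rightarrow> 'a word \<Rightarrow> 'h" where
  "word_eval H h w =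
     foldr (\<lambda>l r. (if snd l then h (fst l) else inv\<^bsub>H\<^esub> h (fst l)) \<otimes>\<^bsub>H\<^esub> r) w \<one>\<^bsub>H\<^esub>"

lemma free_group_lift:
  assumes "group H" "h \<in> A \<rightarrow> carrier H"
  shows "word_eval H h \<in> hom (free_group A) H"
    and "a \<in> A \<Longrightarrow> word_eval H h (free_gen a) = h a"
proof -
  interpret group H by fact
  let ?e = "\<lambda>l. if snd l then h (fst l) else inv\<^bsub>H\<^esub> h (fst l)"
  have E: "word_eval H h (l # w) = ?e l \<otimes>\<^bsub>H\<^esub> word_eval H h w" for l w
    by (simp add: word_eval_def)
  have E0: "word_eval H h [] = \<one>\<^bsub>H\<^esub>" by (simp add: word_eval_def)
  have ec: "?e l \<in> carrier H" if "l \<in> A \<times> UNIV" for l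
    using that assms(2) by auto
  have wc: "word_eval H h w \<in> carrier H" if "w \<in> lists (A \<times> UNIV)" for w
    using that by induction (simp_all only: E E0 one_closed m_closed ec)
  have app: "word_eval H h (u @ v) = word_eval H h u \<otimes>\<^bsub>H\<^esub> word_eval H h v"
    if "u \<in> lists (A \<times> UNIV)" and v: "v \<in> lists (A \<times> UNIV)" for u v
    using that(1)
  proof induction
    case Nil
    then show ?case using wc[OF v] by (simp add: E0)
  next
    case (Cons l u)
    have "word_eval H h ((l # u) @ v) = ?e l \<otimes>\<^bsub>H\<^esub> (word_eval H h u \<otimes>\<^bsub>H\<^esub> word_eval H h v)"
      using Cons by (simp only: append_Cons E)
    also have "\<dots> = word_eval H h (l # u) \<otimes>\<^bsub>H\<^esub> word_eval H h v"
      using m_assoc[OF ec[OF Cons(1)] wc[OF Cons(2)] wc[OF v]] by (simp only: E)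
    finally show ?case .
  qed
  have push: "word_eval H h (push_letter l w) = ?e l \<otimes>\<^bsub>H\<^esub> word_eval H h w"
    if l: "l \<in> A \<times> UNIV" and w: "w \<in> lists (A \<times> UNIV)" for l w
  proof (cases "\<exists>w'. w = letter_inv l # w'")
    case True
    then obtain w' where w': "w = letter_inv l # w'" by blast
    have c: "h (fst l) \<in> carrier H" using l assms(2) by auto
    have d: "word_eval H h w' \<in> carrier H" using w w' wc by simp
    show ?thesis
      using c d by (cases l) (auto simp: w' E letter_inv_def m_assoc[symmetric])
  next
    case False
    then have "push_letter l w = l # w" by (cases w) auto
    then show ?thesis by (simp only: E)
  qed
  have red: "word_eval H h (reduce w) = word_eval H h w" if "w \<in> lists (A \<times> UNIV)" for w
    using that
  proof induction
    case (Cons l w)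
    have "reduce (l # w) = push_letter l (reduce w)" by (simp add: reduce_def)
    then show ?case using push[OF Cons(1) reduce_lists[OF Cons(2)]] Cons(3) by (simp only: E)
  qed (simp add: reduce_def)
  show "word_eval H h \<in> hom (free_group A) H"
  proof (rule homI)
    fix u v assume "u \<in> carrier (free_group A)" "v \<in> carrier (free_group A)"
    then have uv: "u \<in> lists (A \<times> UNIV)" "v \<in> lists (A \<times> UNIV)" by (auto simp: free_group_def)
    have "u @ v \<in> lists (A \<times> UNIV)" using uv by auto
    from red[OF this] app[OF uv]
    show "word_eval H h (u \<otimes>\<^bsub>free_group A\<^esub> v) = word_eval H h u \<otimes>\<^bsub>H\<^esub> word_eval H h v"
      by (simp add: free_group_def)
  qed (use wc in \<open>simp add: free_group_def\<close>)
  show "a \<in> A \<Longrightarrow> word_eval H h (free_gen a) = h a"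
    using assms(2) by (simp add: free_gen_def word_eval_def Pi_iff)
qed

lemma presented_group_lift:
  assumes H: "group H" and h: "h \<in> A \<rightarrow> carrier H"
    and R: "R \<subseteq> carrier (free_group A) \<times> carrier (free_group A)"
    and rel: "\<And>u v. (u, v) \<in> R \<Longrightarrow> word_eval H h u = word_eval H h v"
  shows "\<exists>k \<in> hom (presented_group A R) H. \<forall>a\<in>A. k (pres_gen A R a) = h a"
proof -
  let ?F = "free_group A" and ?e = "word_eval H h"
  let ?N = "normal_closure ?F (relators A R)"
  have e: "group_hom ?F H ?e"
    by (intro group_hom.intro group_hom_axioms.intro group_free_group H free_group_lift(1) h)
  interpret e: group_hom ?F H ?e by (rule e)
  have N: "?N \<lhd> ?F" by (intro normal_normal_closure group_free_group relators_carrier R)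
  have "relators A R \<subseteq> kernel ?F H ?e"
  proof
    fix w assume "w \<in> relators A R"
    then obtain u v where uv: "(u, v) \<in> R" "w = u \<otimes>\<^bsub>?F\<^esub> inv\<^bsub>?F\<^esub> v" by (auto simp: relators_def)
    then have c: "u \<in> carrier ?F" "v \<in> carrier ?F" using R by auto
    then show "w \<in> kernel ?F H ?e"
      using rel[OF uv(1)] by (simp add: kernel_def uv(2))
  qed
  then have "?N \<subseteq> kernel ?F H ?e"
    unfolding normal_closure_def using e.normal_kernel by blast
  then obtain k where "k \<in> hom (?F Mod ?N) H" "\<And>x. x \<in> carrier ?F \<Longrightarrow> k (?N #>\<^bsub>?F\<^esub> x) = ?e x"
    using e.FactGroup_universal_kernel[OF N] by metis
  then show ?thesis
    by (intro bexI[of _ k])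
       (auto simp: presented_group_def pres_gen_def free_gen_carrier free_group_lift(2)[OF H h])
qed


section \<open>Existence of the linear representation\<close>

lemma lookup_scaleR [simp]:
  "Poly_Mapping.lookup (c *\<^sub>R v) y = c *\<^sub>R Poly_Mapping.lookup v y"
proof -
  have "finite {k. c *\<^sub>R Poly_Mapping.lookup v k \<noteq> 0}"
    by (rule finite_subset[OF _ finite_keys[of v]]) (auto simp: in_keys_iff)
  then show ?thesis by (simp add: scaleR_poly_mapping_def)
qed

lemma lookup_comb:
  "finite X \<Longrightarrow> Poly_Mapping.lookup (\<Sum>y\<in>X. c y *\<^sub>R basis_vec y) z = (if z \<in> X then c z else 0)"
  by (simp add: lookup_sum basis_vec_def lookup_single when_def if_distrib cong: if_cong)

lemma comb_free_space: "(\<Sum>y\<in>X. c y *\<^sub>R basis_vec y) \<in> free_space X"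
  unfolding free_space_def by (intro span_sum span_scale span_base imageI)

lemma free_space_iff:
  assumes "finite X"
  shows "v \<in> free_space X \<longleftrightarrow> (\<forall>z. z \<notin> X \<longrightarrow> Poly_Mapping.lookup v z = 0)"
proof
  have "subspace {v :: 'a \<Rightarrow>\<^sub>0 real. \<forall>z. z \<notin> X \<longrightarrow> Poly_Mapping.lookup v z = 0}"
    by (auto simp: subspace_def lookup_add)
  then have "free_space X \<subseteq> {v. \<forall>z. z \<notin> X \<longrightarrow> Poly_Mapping.lookup v z = 0}"
    unfolding free_space_def
    by (intro span_minimal) (auto simp: basis_vec_def lookup_single when_def)
  then show "v \<in> free_space X \<Longrightarrow> \<forall>z. z \<notin> X \<longrightarrow> Poly_Mapping.lookup v z = 0" by auto
next
  assume "\<forall>z. z \<notin> X \<longrightarrow> Poly_Mapping.lookup v z = 0"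
  then have "v = (\<Sum>y\<in>X. Poly_Mapping.lookup v y *\<^sub>R basis_vec y)"
    by (intro poly_mapping_eqI) (simp add: lookup_comb[OF assms])
  then show "v \<in> free_space X" using comb_free_space by metis
qed

lemma sol_psi_basis:
  assumes "finite X" "x \<in> X" "y \<in> X"
  shows "sol_psi X S x (basis_vec y) =
    (if y = x then - basis_vec (sol_phi X S x x) else basis_vec (sol_phi X S x y))"
proof -
  have b: "basis_vec y \<in> free_space X"
    unfolding free_space_def using assms by (intro span_base imageI)
  show ?thesis
    using assms b
    by (simp add: sol_psi_def basis_vec_def lookup_single when_def if_distrib[of "\<lambda>c. c *\<^sub>R _"]
          cong: if_cong)
qed

lemma sol_psi_eq:
  assumes "bij_betw (sol_f S x) X X" "v \<in> free_space X"
  shows "sol_psi X S x v = (\<Sum>z\<in>X. ((if sol_f S x z = x then - 1 else 1) *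
           Poly_Mapping.lookup v (sol_f S x z)) *\<^sub>R basis_vec z)"
proof -
  have "sol_psi X S x v = (\<Sum>y\<in>X. Poly_Mapping.lookup v y *\<^sub>R
       (if y = x then - basis_vec (sol_phi X S x y) else basis_vec (sol_phi X S x y)))"
    using assms(2) by (simp add: sol_psi_def)
  also have "\<dots> = (\<Sum>z\<in>X. Poly_Mapping.lookup v (sol_f S x z) *\<^sub>R
       (if sol_f S x z = x then - basis_vec (sol_phi X S x (sol_f S x z))
        else basis_vec (sol_phi X S x (sol_f S x z))))"
    by (rule sum.reindex_bij_betw[OF assms(1), symmetric])
  also have "\<dots> = (\<Sum>z\<in>X. ((if sol_f S x z = x then - 1 else 1) *
           Poly_Mapping.lookup v (sol_f S x z)) *\<^sub>R basis_vec z)"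
  proof (intro sum.cong refl)
    fix z assume "z \<in> X"
    then have "sol_phi X S x (sol_f S x z) = z"
      unfolding sol_phi_def by (rule bij_betw_inv_into_left[OF assms(1)])
    then show "Poly_Mapping.lookup v (sol_f S x z) *\<^sub>R
       (if sol_f S x z = x then - basis_vec (sol_phi X S x (sol_f S x z))
        else basis_vec (sol_phi X S x (sol_f S x z))) =
       ((if sol_f S x z = x then - 1 else 1) *
           Poly_Mapping.lookup v (sol_f S x z)) *\<^sub>R basis_vec z"
      by (simp only:) simp
  qed
  finally show ?thesis .
qed

lemma lookup_sol_psi:
  assumes "finite X" "bij_betw (sol_f S x) X X" "v \<in> free_space X"
  shows "Poly_Mapping.lookup (sol_psi X S x v) z =
    (if z \<in> X then (if sol_f S x z = x then - 1 else 1) * Poly_Mapping.lookup v (sol_f S x z) else 0)"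
  by (simp only: sol_psi_eq[OF assms(2,3)] lookup_comb[OF assms(1)])

lemma sol_psi_GL:
  assumes X: "finite X" and f: "bij_betw (sol_f S x) X X"
  shows "sol_psi X S x \<in> carrier (GL (free_space X))"
proof -
  let ?V = "free_space X" and ?f = "sol_f S x" and ?T = "sol_psi X S x"
  note L = lookup_sol_psi[OF X f]
  have T: "?T v \<in> ?V" if "v \<in> ?V" for v
    using that by (simp add: free_space_iff[OF X] L)
  define U where "U u = (\<Sum>y\<in>X. ((if y = x then - 1 else 1) *
     Poly_Mapping.lookup u (inv_into X ?f y)) *\<^sub>R basis_vec y)" for u
  have U: "U u \<in> ?V" for u unfolding U_def by (rule comb_free_space)
  have LU: "Poly_Mapping.lookup (U u) y =
     (if y \<in> X then (if y = x then - 1 else 1) * Poly_Mapping.lookup u (inv_into X ?f y) else 0)" for u y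
    unfolding U_def by (rule lookup_comb[OF X])
  have fX: "?f z \<in> X" "inv_into X ?f (?f z) = z" "inv_into X ?f z \<in> X" "?f (inv_into X ?f z) = z"
    if "z \<in> X" for z
    using f that by (auto simp: bij_betw_def inv_into_into f_inv_into_f)
  have UT: "U (?T v) = v" if "v \<in> ?V" for v
    using that by (intro poly_mapping_eqI) (auto simp: LU L fX free_space_iff[OF X])
  have TU: "?T (U u) = u" if "u \<in> ?V" for u
    using that U by (intro poly_mapping_eqI) (auto simp: LU L fX free_space_iff[OF X])
  have "bij_betw ?T ?V ?V"
    by (rule bij_betw_byWitness[where f' = U]) (use UT TU T U in auto)
  moreover have "?T \<in> extensional ?V" by (simp add: sol_psi_def)
  moreover have "?T (u + v) = ?T u + ?T v" if "u \<in> ?V" "v \<in> ?V" for u v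
  proof -
    have "u + v \<in> ?V" using that by (simp add: free_space_def span_add)
    then show ?thesis
      using that by (intro poly_mapping_eqI) (simp add: L lookup_add algebra_simps)
  qed
  moreover have "?T (c *\<^sub>R v) = c *\<^sub>R ?T v" if "v \<in> ?V" for c v
  proof -
    have "c *\<^sub>R v \<in> ?V" using that by (simp add: free_space_def span_scale)
    then show ?thesis
      using that by (intro poly_mapping_eqI) (simp add: L)
  qed
  ultimately show ?thesis by (simp add: GL_def Bij_def)
qed

lemma GL_subgroup:
  assumes V: "subspace V"
  shows "subgroup (carrier (GL V)) (BijGroup V)"
proof -
  interpret B: group "BijGroup V" by (rule group_BijGroup)
  note add = subspace_add[OF V] and scale = subspace_scale[OF V]
  have inv: "inv\<^bsub>BijGroup V\<^esub> T = restrict (inv_into V T) V" if "T \<in> Bij V" for T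
    using that by (rule inv_BijGroup)
  show ?thesis
  proof (rule B.subgroupI)
    show "carrier (GL V) \<subseteq> carrier (BijGroup V)" by (auto simp: GL_def BijGroup_def)
    have "(\<lambda>v\<in>V. v) \<in> carrier (GL V)" by (simp add: GL_def id_Bij add scale)
    then show "carrier (GL V) \<noteq> {}" by blast
  next
    fix T assume "T \<in> carrier (GL V)"
    then have T: "T \<in> Bij V" "\<And>u v. u \<in> V \<Longrightarrow> v \<in> V \<Longrightarrow> T (u + v) = T u + T v"
      "\<And>c v. v \<in> V \<Longrightarrow> T (c *\<^sub>R v) = c *\<^sub>R T v" by (auto simp: GL_def)
    let ?U = "inv_into V T"
    have b: "bij_betw T V V" using T(1) by (simp add: Bij_def)
    have U: "?U v \<in> V" "T (?U v) = v" "?U (T v) = v" if "v \<in> V" for v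
      using b that by (auto simp: bij_betw_def inv_into_into f_inv_into_f)
    have "?U (u + v) = ?U u + ?U v" if "u \<in> V" "v \<in> V" for u v
      using U(3)[OF add[OF U(1)[OF that(1)] U(1)[OF that(2)]]] that by (simp add: T U)
    moreover have "?U (c *\<^sub>R v) = c *\<^sub>R ?U v" if "v \<in> V" for c v
      using U(3)[OF scale[OF U(1)[OF that]], of c] that by (simp add: T U)
    ultimately show "inv\<^bsub>BijGroup V\<^esub> T \<in> carrier (GL V)"
      using restrict_inv_into_Bij[OF T(1)] by (simp add: inv[OF T(1)] GL_def add scale)
  next
    fix T U assume "T \<in> carrier (GL V)" "U \<in> carrier (GL V)"
    then have T: "T \<in> Bij V" "\<And>u v. u \<in> V \<Longrightarrow> v \<in> V \<Longrightarrow> T (u + v) = T u + T v"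
        "\<And>c v. v \<in> V \<Longrightarrow> T (c *\<^sub>R v) = c *\<^sub>R T v"
      and U: "U \<in> Bij V" "\<And>u v. u \<in> V \<Longrightarrow> v \<in> V \<Longrightarrow> U (u + v) = U u + U v"
        "\<And>c v. v \<in> V \<Longrightarrow> U (c *\<^sub>R v) = c *\<^sub>R U v" by (auto simp: GL_def)
    have "U v \<in> V" if "v \<in> V" for v using U(1) that by (auto simp: Bij_def bij_betw_def)
    then show "T \<otimes>\<^bsub>BijGroup V\<^esub> U \<in> carrier (GL V)"
      using T U by (simp add: GL_def BijGroup_def compose_Bij) (simp add: compose_def add scale)
  qed
qed

lemma subspace_free_space: "subspace (free_space X)"
  by (simp add: free_space_def)

lemma group_GL: "subspace V \<Longrightarrow> group (GL V)"
  using subgroup.subgroup_is_group[OF GL_subgroup group_BijGroup] by (simp add: GL_def)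

lemma GL_mult:
  "T \<in> carrier (GL V) \<Longrightarrow> U \<in> carrier (GL V) \<Longrightarrow> T \<otimes>\<^bsub>GL V\<^esub> U = compose V T U"
  by (simp add: GL_def BijGroup_def)

lemma sol_psi_relation:
  assumes X: "finite X" and sol: "nondegenerate_symmetric_solution X S"
    and x: "x \<in> X" and y: "y \<in> X"
  shows "sol_psi X S x \<otimes>\<^bsub>GL (free_space X)\<^esub> sol_psi X S y =
    sol_psi X S (sol_g S x y) \<otimes>\<^bsub>GL (free_space X)\<^esub> sol_psi X S (sol_f S y x)"
proof -
  let ?V = "free_space X"
  define z t where "z = sol_g S x y" and "t = sol_f S y x"
  have f: "bij_betw (sol_f S a) X X" and g: "bij_betw (sol_g S a) X X" if "a \<in> X" for a
    using sol that by (auto simp: nondegenerate_symmetric_solution_def nondegenerate_def)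
  have zt: "z \<in> X" "t \<in> X"
    using f[OF y] g[OF x] x y by (auto simp: z_def t_def bij_betw_def)
  have S: "S (x, y) = (z, t)" by (simp add: z_def t_def sol_g_def sol_f_def)
  have "S (S (x, y)) = (x, y)"
    using sol x y by (auto simp: nondegenerate_symmetric_solution_def involutive_def)
  then have ftz: "sol_f S t z = y" by (simp add: S sol_f_def)
  have ff: "sol_f S y (sol_f S x w) = sol_f S t (sol_f S z w)" if w: "w \<in> X" for w
  proof -
    have "S12 S (S23 S (S12 S (w, x, y))) = S23 S (S12 S (S23 S (w, x, y)))"
      using sol w x y unfolding nondegenerate_symmetric_solution_def braided_def by blast
    then have "snd (snd (S12 S (S23 S (S12 S (w, x, y))))) = snd (snd (S23 S (S12 S (S23 S (w, x, y)))))"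
      by simp
    then show ?thesis by (simp add: S12_def S23_def S sol_f_def Let_def split_beta)
  qed
  have fX: "sol_f S a w \<in> X" if "a \<in> X" "w \<in> X" for a w
    using f[OF that(1)] that(2) by (auto simp: bij_betw_def)
  have inj: "sol_f S a v = sol_f S a w \<longleftrightarrow> v = w" if "a \<in> X" "v \<in> X" "w \<in> X" for a v w
    using f[OF that(1)] that(2,3) by (auto simp: bij_betw_def inj_on_def)
  have psiV: "sol_psi X S a v \<in> ?V" if "a \<in> X" "v \<in> ?V" for a v
    using sol_psi_GL[OF X f[OF that(1)]] that(2) by (auto simp: GL_def Bij_def bij_betw_def)
  have "sol_psi X S x (sol_psi X S y v) = sol_psi X S z (sol_psi X S t v)" if v: "v \<in> ?V" for v
  proof (rule poly_mapping_eqI)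
    fix w
    show "Poly_Mapping.lookup (sol_psi X S x (sol_psi X S y v)) w =
          Poly_Mapping.lookup (sol_psi X S z (sol_psi X S t v)) w"
    proof (cases "w \<in> X")
      case w: True
      have 1: "sol_f S x w = x \<longleftrightarrow> sol_f S t (sol_f S z w) = t"
        using inj[OF y fX[OF x w] x] ff[OF w] by (simp add: t_def)
      have 2: "sol_f S z w = z \<longleftrightarrow> sol_f S t (sol_f S z w) = y"
        using inj[OF zt(2) fX[OF zt(1) w] zt(1)] ftz by simp
      show ?thesis
        using w v by (simp add: lookup_sol_psi X f x y zt psiV fX ff 1 2)
    qed (use v in \<open>simp add: lookup_sol_psi X f x y zt psiV\<close>)
  qed
  then have "compose ?V (sol_psi X S x) (sol_psi X S y) = compose ?V (sol_psi X S z) (sol_psi X S t)"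
    by (auto simp: compose_def)
  then show ?thesis
    using zt by (simp add: GL_mult sol_psi_GL X f x y flip: z_def t_def)
qed

lemma sol_range:
  assumes "nondegenerate_symmetric_solution X S" "x \<in> X" "y \<in> X"
  shows "sol_g S x y \<in> X" "sol_f S y x \<in> X"
proof -
  have "bij_betw (sol_g S x) X X" "bij_betw (sol_f S y) X X"
    using assms by (auto simp: nondegenerate_symmetric_solution_def nondegenerate_def)
  then show "sol_g S x y \<in> X" "sol_f S y x \<in> X"
    using assms(2,3) by (simp_all add: bij_betw_apply)
qed

lemma structure_relations_carrier:
  assumes "nondegenerate_symmetric_solution X S"
  shows "structure_relations X S \<subseteq> carrier (free_group X) \<times> carrier (free_group X)"
proof -
  interpret group "free_group X" by (rule group_free_group)
  show ?thesis by (auto simp: structure_relations_def free_gen_carrier sol_range[OF assms])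
qed

lemma structure_rep:
  assumes X: "finite X" and sol: "nondegenerate_symmetric_solution X S"
  shows "structure_rep X S \<in> hom (structure_group X S) (GL (free_space X))"
    and "x \<in> X \<Longrightarrow> structure_rep X S (pres_gen X (structure_relations X S) x) = sol_psi X S x"
proof -
  let ?H = "GL (free_space X)" and ?h = "sol_psi X S"
  have H: "group ?H" by (intro group_GL subspace_free_space)
  have h: "?h \<in> X \<rightarrow> carrier ?H"
    using sol X
    by (auto intro!: sol_psi_GL simp: nondegenerate_symmetric_solution_def nondegenerate_def)
  note gf = sol_range[OF sol]
  have two: "word_eval ?H ?h (free_gen x \<otimes>\<^bsub>free_group X\<^esub> free_gen y) = ?h x \<otimes>\<^bsub>?H\<^esub> ?h y"
    if "x \<in> X" "y \<in> X" for x y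
    using hom_mult[OF free_group_lift(1)[OF H h] free_gen_carrier free_gen_carrier] that
    by (simp add: free_group_lift(2)[OF H h])
  have "\<exists>k \<in> hom (presented_group X (structure_relations X S)) ?H.
      \<forall>x\<in>X. k (pres_gen X (structure_relations X S) x) = ?h x"
  proof (rule presented_group_lift[OF H h structure_relations_carrier[OF sol]])
    fix u v assume "(u, v) \<in> structure_relations X S"
    then obtain x y where xy: "x \<in> X" "y \<in> X"
      and "u = free_gen x \<otimes>\<^bsub>free_group X\<^esub> free_gen y"
      and "v = free_gen (sol_g S x y) \<otimes>\<^bsub>free_group X\<^esub> free_gen (sol_f S y x)"
      by (auto simp: structure_relations_def)
    then show "word_eval ?H ?h u = word_eval ?H ?h v"
      using sol_psi_relation[OF X sol xy] by (simp add: two gf[OF xy])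
  qed
  then have "\<exists>k. k \<in> hom (structure_group X S) ?H \<and>
      (\<forall>x\<in>X. k (pres_gen X (structure_relations X S) x) = ?h x)"
    unfolding structure_group_def by blast
  note someI_ex[OF this, folded structure_rep_def]
  then show "structure_rep X S \<in> hom (structure_group X S) ?H"
    "x \<in> X \<Longrightarrow> structure_rep X S (pres_gen X (structure_relations X S) x) = ?h x" by auto
qed

end

theory Submission
  imports Defs "HOL-Algebra.Generated_Groups" "HOL-Library.Multiset"
begin

text \<open>Put \<open>\<gamma>\<^sub>x = g\<^sub>x\<inverse>\<close>. In any group generated by a family \<open>h\<close> indexed by \<open>X\<close> that satisfies the
  relations, the twisted product \<open>h x\<^sub>1 \<cdot> h (\<gamma> x\<^sub>1 x\<^sub>2) \<cdots>\<close> of a list (twisting all later entries by each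
  successive letter) does not depend on the order of the list, by the relations and the braid
  equation, and two equal entries cancel, by Property C. Twisted products exhaust the group, so it
  has at most \<open>2\<^sup>n\<close> elements. Conversely, each vector with all coordinates \<open>\<plusminus>1\<close> is the image of the
  all-ones vector under some element of \<open>W\<close>, so \<open>W\<close> has at least \<open>2\<^sup>n\<close> elements, and the surjection
  from the presented group onto \<open>W\<close> is bijective.\<close>

section \<open>Generators and relations of a presented group\<close>

text \<open>Induction on the length of a reduced word, splitting off its first letter; a letter with
  sign \<open>False\<close> is the inverse of a generator.\<close>

lemma free_group_generate:
  "carrier (free_group A) = generate (free_group A) (free_gen ` A)"
proof
  interpret group "free_group A" by (rule group_free_group)
  let ?G = "generate (free_group A) (free_gen ` A)"
  show "?G \<subseteq> carrier (free_group A)"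
    by (rule generate_incl) (auto simp: free_gen_carrier)
  have "w \<in> ?G" if "w \<in> lists (A \<times> UNIV)" "reduced w" for w
    using that
  proof (induction w rule: list.induct)
    case Nil
    show ?case using generate.one[of "free_group A"] by (simp add: free_group_def)
  next
    case (Cons l w)
    obtain a b where l: "l = (a, b)" by (cases l)
    have a: "a \<in> A" using Cons.prems by (simp add: l)
    have w: "w \<in> ?G" using Cons.prems reduced_ConsD by (intro Cons.IH) auto
    have "[l] \<in> ?G"
    proof (cases b)
      case True
      then show ?thesis using a generate.incl[of "free_gen a" "free_gen ` A" "free_group A"]
        by (simp add: l free_gen_def)
    next
      case False
      have "[(a, False)] \<otimes>\<^bsub>free_group A\<^esub> free_gen a = \<one>\<^bsub>free_group A\<^esub>"
        by (simp add: free_group_def free_gen_def reduce_def letter_inv_def)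
      moreover have "[(a, False)] \<in> carrier (free_group A)"
        using a by (simp add: free_group_def reduced_def)
      ultimately have "inv\<^bsub>free_group A\<^esub> free_gen a = [(a, False)]"
        using a by (simp add: inv_equality free_gen_carrier)
      then show ?thesis using False a generate.inv[of "free_gen a" "free_gen ` A" "free_group A"]
        by (simp add: l)
    qed
    then have "[l] \<otimes>\<^bsub>free_group A\<^esub> w \<in> ?G" using w by (rule generate.eng)
    \<comment> \<open>The word \<open>l # w\<close> is already reduced, so nothing cancels when
      \<open>[l]\<close> is multiplied by \<open>w\<close>.\<close>
    then show ?case using reduce_reduced[OF Cons.prems(2)] by (simp add: free_group_def)
  qed
  then show "carrier (free_group A) \<subseteq> ?G" by (auto simp: free_group_def)
qed

lemma presented_group_proj:
  assumes "R \<subseteq> carrier (free_group A) \<times> carrier (free_group A)"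
  shows "group_hom (free_group A) (presented_group A R)
    (\<lambda>w. normal_closure (free_group A) (relators A R) #>\<^bsub>free_group A\<^esub> w)"
  using normal.r_coset_hom_Mod[OF normal_normal_closure[OF group_free_group relators_carrier[OF assms]]]
  by (intro group_hom.intro group_hom_axioms.intro group_free_group group_presented_group assms)
     (simp add: presented_group_def)

text \<open>The quotient projection is a surjective homomorphism, and homomorphisms carry generated
  subgroups to generated subgroups.\<close>

lemma presented_group_generate:
  assumes "R \<subseteq> carrier (free_group A) \<times> carrier (free_group A)"
  shows "carrier (presented_group A R) = generate (presented_group A R) (pres_gen A R ` A)"
proof -
  let ?N = "normal_closure (free_group A) (relators A R)"
  interpret p: group_hom "free_group A" "presented_group A R" "\<lambda>w. ?N #>\<^bsub>free_group A\<^esub> w"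
    by (rule presented_group_proj[OF assms])
  have "carrier (presented_group A R) = (\<lambda>w. ?N #>\<^bsub>free_group A\<^esub> w) ` carrier (free_group A)"
    by (auto simp: presented_group_def FactGroup_def RCOSETS_def)
  also have "\<dots> = generate (presented_group A R) ((\<lambda>w. ?N #>\<^bsub>free_group A\<^esub> w) ` free_gen ` A)"
    unfolding free_group_generate by (rule p.generate_img[symmetric]) (auto simp: free_gen_carrier)
  finally show ?thesis by (simp add: image_image pres_gen_def[abs_def])
qed

lemma presented_group_relation:
  assumes R: "R \<subseteq> carrier (free_group A) \<times> carrier (free_group A)" and uv: "(u, v) \<in> R"
  shows "normal_closure (free_group A) (relators A R) #>\<^bsub>free_group A\<^esub> u =
    normal_closure (free_group A) (relators A R) #>\<^bsub>free_group A\<^esub> v"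
proof -
  let ?F = "free_group A" and ?N = "normal_closure (free_group A) (relators A R)"
  have N: "?N \<lhd> ?F" by (intro normal_normal_closure group_free_group relators_carrier R)
  interpret normal ?N ?F by (rule N)
  have c: "u \<in> carrier ?F" "v \<in> carrier ?F" using R uv by auto
  have "u \<otimes>\<^bsub>?F\<^esub> inv\<^bsub>?F\<^esub> v \<in> ?N"
    using uv unfolding normal_closure_def relators_def by blast
  then have "(u \<otimes>\<^bsub>?F\<^esub> inv\<^bsub>?F\<^esub> v) \<otimes>\<^bsub>?F\<^esub> v \<in> ?N #>\<^bsub>?F\<^esub> v" by (auto simp: r_coset_def)
  then have "u \<in> ?N #>\<^bsub>?F\<^esub> v" using c by (simp add: m_assoc)
  then show ?thesis using repr_independence[OF _ c(2) subgroup_axioms] by simp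
qed


section \<open>Twisted products\<close>

locale symmetric_solution =
  fixes X :: "'a set" and S :: "'a \<times> 'a \<Rightarrow> 'a \<times> 'a"
  assumes sol: "nondegenerate_symmetric_solution X S"
begin

text \<open>This is the cycle set operation of the solution: in the coordinates
  \<open>(x, \<gamma> x y)\<close> the map \<open>S\<close> just exchanges \<open>x\<close> and
  \<open>y\<close>.\<close>

definition \<gamma> :: "'a \<Rightarrow> 'a \<Rightarrow> 'a" where
  "\<gamma> x = inv_into X (sol_g S x)"

lemma bij_g: "x \<in> X \<Longrightarrow> bij_betw (sol_g S x) X X"
  and bij_f: "x \<in> X \<Longrightarrow> bij_betw (sol_f S x) X X"
  using sol by (auto simp: nondegenerate_symmetric_solution_def nondegenerate_def)

lemmas gf_closed = sol_range[OF sol]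

lemma \<gamma>_closed [simp]: "x \<in> X \<Longrightarrow> y \<in> X \<Longrightarrow> \<gamma> x y \<in> X"
  unfolding \<gamma>_def using bij_g by (metis bij_betw_def inv_into_into)

lemma g_\<gamma> [simp]: "x \<in> X \<Longrightarrow> y \<in> X \<Longrightarrow> sol_g S x (\<gamma> x y) = y"
  unfolding \<gamma>_def using bij_g by (metis bij_betw_inv_into_right)

lemma \<gamma>_g [simp]: "x \<in> X \<Longrightarrow> y \<in> X \<Longrightarrow> \<gamma> x (sol_g S x y) = y"
  unfolding \<gamma>_def using bij_g by (metis bij_betw_inv_into_left)

lemma S_eq: "S (x, y) = (sol_g S x y, sol_f S y x)"
  by (simp add: sol_g_def sol_f_def)

text \<open>The first component is \<open>y\<close> because \<open>g\<close> undoes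
  \<open>\<gamma>\<close>. Involutivity returns \<open>(y, t)\<close> to a pair with first entry
  \<open>x\<close>, which determines \<open>t\<close>.\<close>

lemma S_\<gamma>:
  assumes "x \<in> X" "y \<in> X"
  shows "S (x, \<gamma> x y) = (y, \<gamma> y x)"
proof -
  define t where "t = sol_f S (\<gamma> x y) x"
  have t: "t \<in> X" using assms by (simp add: t_def gf_closed)
  have S: "S (x, \<gamma> x y) = (y, t)" using assms by (simp add: S_eq t_def)
  have "S (S (x, \<gamma> x y)) = (x, \<gamma> x y)"
    using sol assms by (auto simp: nondegenerate_symmetric_solution_def involutive_def)
  then have "sol_g S y t = x" by (simp add: S sol_g_def)
  then have "t = \<gamma> y x" using \<gamma>_g[OF assms(2) t] by simp
  then show ?thesis by (simp add: S)
qed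

text \<open>First component of the braid equation.\<close>

lemma g_g:
  assumes "x \<in> X" "y \<in> X" "z \<in> X"
  shows "sol_g S x (sol_g S y z) = sol_g S (sol_g S x y) (sol_g S (sol_f S y x) z)"
proof -
  have "S12 S (S23 S (S12 S (x, y, z))) = S23 S (S12 S (S23 S (x, y, z)))"
    using sol assms unfolding nondegenerate_symmetric_solution_def braided_def by blast
  from arg_cong[OF this, of fst] show ?thesis
    by (simp add: S12_def S23_def S_eq Let_def split_beta)
qed

text \<open>The cycle set identity: \<open>g_g\<close> for the pair
  \<open>(x, \<gamma> x y)\<close>, which \<open>S\<close> sends to
  \<open>(y, \<gamma> y x)\<close>, read for the inverse maps.\<close>

lemma \<gamma>_\<gamma>:
  assumes "x \<in> X" "y \<in> X" "z \<in> X"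
  shows "\<gamma> (\<gamma> x y) (\<gamma> x z) = \<gamma> (\<gamma> y x) (\<gamma> y z)"
proof -
  let ?w = "\<gamma> (\<gamma> y x) (\<gamma> y z)"
  have f: "sol_f S (\<gamma> x y) x = \<gamma> y x" using S_\<gamma>[OF assms(1,2)] by (simp add: S_eq)
  have "sol_g S x (sol_g S (\<gamma> x y) ?w) = z"
    using g_g[OF assms(1), of "\<gamma> x y" ?w] assms by (simp add: f)
  moreover have "sol_g S (\<gamma> x y) ?w \<in> X" using assms by (simp add: gf_closed)
  ultimately have "sol_g S (\<gamma> x y) ?w = \<gamma> x z" using assms \<gamma>_g by metis
  then show ?thesis using assms \<gamma>_g[of "\<gamma> x y" ?w] by simp
qed

text \<open>The diagonal case of \<open>S_\<gamma>\<close>: every element starts a frozen pair. Such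
  pairs give cancellation, inverses and the choice of sign flips below.\<close>

lemma frozen_\<gamma>: "x \<in> X \<Longrightarrow> S (x, \<gamma> x x) = (x, \<gamma> x x)"
  by (rule S_\<gamma>)

lemma \<gamma>_cancel:
  assumes C: "property_C X S" and xz: "x \<in> X" "z \<in> X"
  shows "\<gamma> (\<gamma> x x) (\<gamma> x z) = z"
proof -
  have "sol_g S x (sol_g S (\<gamma> x x) z) = z"
    using C frozen_\<gamma> xz \<gamma>_closed by (auto simp: property_C_def)
  then have "sol_g S (\<gamma> x x) z = \<gamma> x z" using xz \<gamma>_g gf_closed \<gamma>_closed by metis
  then show ?thesis using xz \<gamma>_g[of "\<gamma> x x" z] by simp
qed

end

section \<open>Order independence and cancellation of twisted products\<close>

locale solution_quotient = symmetric_solution X S + group H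
  for X :: "'a set" and S :: "'a \<times> 'a \<Rightarrow> 'a \<times> 'a" and H (structure) +
  fixes h :: "'a \<Rightarrow> 'b"
  assumes C: "property_C X S"
    and h: "h \<in> X \<rightarrow> carrier H"
    and rel: "x \<in> X \<Longrightarrow> y \<in> X \<Longrightarrow> S (x, y) \<noteq> (x, y) \<Longrightarrow>
      h x \<otimes> h y = h (sol_g S x y) \<otimes> h (sol_f S y x)"
    and rel_frozen: "x \<in> X \<Longrightarrow> y \<in> X \<Longrightarrow> S (x, y) = (x, y) \<Longrightarrow> h x \<otimes> h y = \<one>"
begin

text \<open>The twist turns the relations into commutation of neighbouring labels, as in an
  I-structure. The recursive call is on a twisted tail of the same length, not on a sublist, so
  later inductions follow \<open>tprod.induct\<close> or the length.\<close>

fun tprod :: "'a list \<Rightarrow> 'b" where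
  "tprod [] = \<one>"
| "tprod (x # xs) = h x \<otimes> tprod (map (\<gamma> x) xs)"

lemma h_closed [simp]: "x \<in> X \<Longrightarrow> h x \<in> carrier H"
  using h by auto

lemma map_\<gamma>_closed: "x \<in> X \<Longrightarrow> set xs \<subseteq> X \<Longrightarrow> set (map (\<gamma> x) xs) \<subseteq> X"
  by auto

lemma tprod_closed [simp]: "set xs \<subseteq> X \<Longrightarrow> tprod xs \<in> carrier H"
proof (induction xs rule: tprod.induct)
  case (2 x xs)
  then have "tprod (map (\<gamma> x) xs) \<in> carrier H"
    by (intro "2.IH" map_\<gamma>_closed) auto
  then show ?case using 2 by simp
qed simp

text \<open>Isolates a product of two generators to which a relation applies, and the accumulated
  twist of the tail, which \<open>\<gamma>_\<gamma>\<close> shows to be symmetric in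
  \<open>x\<close> and \<open>y\<close>.\<close>

lemma tprod_Cons2:
  assumes "x \<in> X" "y \<in> X" "set zs \<subseteq> X"
  shows "tprod (x # y # zs) = (h x \<otimes> h (\<gamma> x y)) \<otimes> tprod (map (\<lambda>z. \<gamma> (\<gamma> x y) (\<gamma> x z)) zs)"
proof -
  have "tprod (map (\<lambda>z. \<gamma> (\<gamma> x y) (\<gamma> x z)) zs) \<in> carrier H"
    using assms by (intro tprod_closed) auto
  then show ?thesis using assms by (simp add: m_assoc comp_def)
qed

lemma tprod_swap:
  assumes "x \<in> X" "y \<in> X" "set zs \<subseteq> X"
  shows "tprod (x # y # zs) = tprod (y # x # zs)"
proof (cases "x = y")
  case False
  \<comment> \<open>The pair is mapped to one with first entry \<open>y\<close>, so for distinct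
    labels it is not frozen and \<open>rel\<close> applies.\<close>
  have "S (x, \<gamma> x y) \<noteq> (x, \<gamma> x y)" using False S_\<gamma>[OF assms(1,2)] by simp
  moreover have "sol_g S x (\<gamma> x y) = y" "sol_f S (\<gamma> x y) x = \<gamma> y x"
    using S_\<gamma>[OF assms(1,2)] by (auto simp: S_eq)
  ultimately have "h x \<otimes> h (\<gamma> x y) = h y \<otimes> h (\<gamma> y x)"
    using rel[of x "\<gamma> x y"] assms by simp
  moreover have "map (\<lambda>z. \<gamma> (\<gamma> x y) (\<gamma> x z)) zs = map (\<lambda>z. \<gamma> (\<gamma> y x) (\<gamma> y z)) zs"
    using assms \<gamma>_\<gamma>[OF assms(1,2)] by (intro map_cong refl) auto
  ultimately show ?thesis using assms by (simp only: tprod_Cons2)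
qed simp

text \<open>The two leading factors form a frozen pair and multiply to the identity; the double
  twist of the tail is trivial by \<open>\<gamma>_cancel\<close>.\<close>

lemma tprod_cancel:
  assumes "x \<in> X" "set zs \<subseteq> X"
  shows "tprod (x # x # zs) = tprod zs"
proof -
  have "map (\<lambda>z. \<gamma> (\<gamma> x x) (\<gamma> x z)) zs = zs"
    using assms \<gamma>_cancel[OF C assms(1)] by (intro map_idI) auto
  then show ?thesis
    using assms rel_frozen[OF _ _ frozen_\<gamma>[OF assms(1)]] by (simp only: tprod_Cons2) simp
qed

lemma tprod_move_front:
  "set xs \<subseteq> X \<Longrightarrow> y \<in> X \<Longrightarrow> set zs \<subseteq> X \<Longrightarrow> tprod (xs @ y # zs) = tprod (y # xs @ zs)"
proof (induction "length xs" arbitrary: xs y zs)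
  case (Suc n)
  then obtain x ys where xs: "xs = x # ys" "length ys = n" by (cases xs) auto
  have x: "x \<in> X" using Suc.prems xs by simp
  \<comment> \<open>The induction hypothesis moves the twisted copy of \<open>y\<close> to the front
    of the twisted tail; a swap with \<open>x\<close> finishes.\<close>
  have "tprod (map (\<gamma> x) ys @ \<gamma> x y # map (\<gamma> x) zs) = tprod (\<gamma> x y # map (\<gamma> x) ys @ map (\<gamma> x) zs)"
    using Suc.prems xs by (intro Suc.hyps(1)) auto
  then have "tprod (xs @ y # zs) = tprod (x # y # ys @ zs)" by (simp add: xs)
  then show ?case using tprod_swap[OF x, of y "ys @ zs"] Suc.prems by (simp add: xs)
qed simp

text \<open>Bring the head of \<open>xs\<close> to the front of \<open>ys\<close>. What remains has
  equal multisets, also after twisting both sides by that head.\<close>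

lemma tprod_perm: "mset xs = mset ys \<Longrightarrow> set xs \<subseteq> X \<Longrightarrow> tprod xs = tprod ys"
proof (induction "length xs" arbitrary: xs ys)
  case (Suc n)
  then obtain x zs where xs: "xs = x # zs" "length zs = n" by (cases xs) auto
  have sub: "set ys \<subseteq> X" using Suc.prems mset_eq_setD by metis
  have "x \<in> set ys" using Suc.prems(1) by (metis list.set_intros(1) mset_eq_setD xs(1))
  then obtain as bs where ys: "ys = as @ x # bs" by (meson split_list)
  have "mset zs = mset (as @ bs)" using Suc.prems(1) by (simp add: xs ys)
  then have "mset (map (\<gamma> x) zs) = mset (map (\<gamma> x) (as @ bs))" by (simp only: mset_map)
  then have "tprod (map (\<gamma> x) zs) = tprod (map (\<gamma> x) (as @ bs))"
    using Suc.prems(2) xs by (intro Suc.hyps(1)) auto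
  then have "tprod xs = tprod (x # as @ bs)" by (simp add: xs)
  also have "\<dots> = tprod ys" using sub tprod_move_front[of as x bs] by (simp add: ys)
  finally show ?case .
qed simp

section \<open>Twisted products exhaust the group: the upper bound\<close>

lemma tprod_distinct:
  "set xs \<subseteq> X \<Longrightarrow> \<exists>ys. distinct ys \<and> set ys \<subseteq> X \<and> tprod ys = tprod xs"
proof (induction "length xs" arbitrary: xs rule: less_induct)
  case less
  show ?case
  proof (cases "distinct xs")
    case False
    then obtain as bs cs y where xs: "xs = as @ [y] @ bs @ [y] @ cs"
      using not_distinct_decomp by blast
    have "tprod xs = tprod (y # y # as @ bs @ cs)"
      using less.prems by (intro tprod_perm) (auto simp: xs)
    also have "\<dots> = tprod (as @ bs @ cs)"
      using less.prems by (intro tprod_cancel) (auto simp: xs)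
    finally show ?thesis using less.hyps[of "as @ bs @ cs"] less.prems by (simp add: xs)
  qed (use less.prems in blast)
qed

text \<open>The entries are untwisted in advance by \<open>g\<close>, so that the twist of the new
  head restores them.\<close>

lemma h_tprod:
  assumes "x \<in> X" "set zs \<subseteq> X"
  shows "h x \<otimes> tprod zs = tprod (x # map (sol_g S x) zs)"
proof -
  have "map (\<gamma> x \<circ> sol_g S x) zs = zs" using assms by (intro map_idI) auto
  then show ?thesis by simp
qed

lemma tprod_mult:
  "set xs \<subseteq> X \<Longrightarrow> set ys \<subseteq> X \<Longrightarrow> \<exists>zs. set zs \<subseteq> X \<and> tprod xs \<otimes> tprod ys = tprod zs"
proof (induction xs rule: tprod.induct)
  case (2 x xs)
  have x: "x \<in> X" and sub: "set (map (\<gamma> x) xs) \<subseteq> X" using 2 by auto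
  then obtain zs where zs: "set zs \<subseteq> X" "tprod (map (\<gamma> x) xs) \<otimes> tprod ys = tprod zs"
    using 2 by blast
  have "tprod (x # xs) \<otimes> tprod ys = h x \<otimes> tprod zs"
    using x tprod_closed[OF sub] "2.prems" by (simp add: m_assoc zs(2)[symmetric])
  also have "\<dots> = tprod (x # map (sol_g S x) zs)" by (rule h_tprod[OF x zs(1)])
  finally show ?case
    using x zs(1) by (intro exI[of _ "x # map (sol_g S x) zs"]) (auto simp: gf_closed)
qed auto

lemma generate_tprod: "a \<in> generate H (h ` X) \<Longrightarrow> \<exists>xs. set xs \<subseteq> X \<and> a = tprod xs"
proof (induction rule: generate.induct)
  case one
  show ?case by (intro exI[of _ "[]"]) simp
next
  case (incl a)
  then obtain x where "x \<in> X" "a = h x" by blast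
  then show ?case by (intro exI[of _ "[x]"]) simp
next
  case (inv a)
  then obtain x where x: "x \<in> X" "a = h x" by blast
  have "h x \<otimes> h (\<gamma> x x) = \<one>" using x by (simp add: rel_frozen frozen_\<gamma>)
  then have "inv h x = h (\<gamma> x x)" using x by (metis \<gamma>_closed h_closed inv_comm inv_equality)
  then show ?case using x by (intro exI[of _ "[\<gamma> x x]"]) simp
next
  case (eng a b)
  then show ?case using tprod_mult by metis
qed

text \<open>A list may be made distinct without changing its twisted product, and its order does not
  matter; hence each group element is determined by a subset of \<open>X\<close>.\<close>

lemma card_le:
  assumes X: "finite X" and gen: "carrier H = generate H (h ` X)"
  shows "finite (carrier H)" "card (carrier H) \<le> 2 ^ card X"
proof -
  define p where "p B = tprod (SOME xs. distinct xs \<and> set xs = B)" for B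
  have "carrier H \<subseteq> p ` Pow X"
  proof
    fix a assume "a \<in> carrier H"
    then obtain xs where xs: "distinct xs" "set xs \<subseteq> X" "a = tprod xs"
      using generate_tprod gen tprod_distinct by metis
    \<comment> \<open>The enumeration that \<open>p\<close> selects for the set of
      \<open>xs\<close>; \<open>xs\<close> itself witnesses that one exists.\<close>
    define ys where "ys = (SOME ys. distinct ys \<and> set ys = set xs)"
    have "distinct ys \<and> set ys = set xs"
      unfolding ys_def by (rule someI[of _ xs]) (simp add: xs)
    then have "mset xs = mset ys" using xs(1) set_eq_iff_mset_eq_distinct by blast
    then have "a = p (set xs)"
      using tprod_perm xs by (simp add: p_def flip: ys_def)
    then show "a \<in> p ` Pow X" using xs(2) by blast
  qed
  with X have "finite (carrier H)" "card (carrier H) \<le> card (Pow X)"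
    by (simp_all add: finite_subset surj_card_le)
  then show "finite (carrier H)" "card (carrier H) \<le> 2 ^ card X"
    using X by (simp_all add: card_Pow)
qed

end


section \<open>The linear group\<close>

context symmetric_solution
begin

abbreviation "GLX \<equiv> GL (free_space X)"

lemma group_GLX: "group GLX"
  by (intro group_GL subspace_free_space)

lemma psi_GL: "finite X \<Longrightarrow> x \<in> X \<Longrightarrow> sol_psi X S x \<in> carrier GLX"
  by (intro sol_psi_GL bij_f)

lemma psi_closed: "finite X \<Longrightarrow> x \<in> X \<Longrightarrow> v \<in> free_space X \<Longrightarrow> sol_psi X S x v \<in> free_space X"
  using psi_GL[of x] by (auto simp: GL_def Bij_def bij_betw_def)

text \<open>At coordinate \<open>z\<close>, the map \<open>f\<close> of \<open>y\<close> after that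
  of \<open>x\<close> is the identity by Property C. The two sign conditions both amount to
  \<open>z = y\<close>, so the signs cancel.\<close>

lemma psi_frozen:
  assumes X: "finite X" and C: "property_C X S"
    and xy: "x \<in> X" "y \<in> X" and fr: "S (x, y) = (x, y)"
  shows "sol_psi X S x \<otimes>\<^bsub>GLX\<^esub> sol_psi X S y = \<one>\<^bsub>GLX\<^esub>"
proof -
  have id: "sol_f S y (sol_f S x z) = z" if "z \<in> X" for z
    using C xy fr that by (auto simp: property_C_def)
  have fyx: "sol_f S y x = y" using fr by (simp add: sol_f_def)
  \<comment> \<open>Apply the injective \<open>sol_f S y\<close> to both sides, using that it sends
    \<open>x\<close> to \<open>y\<close>.\<close>
  have eq: "sol_f S x z = x \<longleftrightarrow> z = y" if "z \<in> X" for z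
    using id fyx that xy(1) bij_betw_imp_inj_on[OF bij_f[OF xy(2)]] gf_closed(2)[OF that xy(1)]
    by (metis inj_onD)
  have "sol_psi X S x (sol_psi X S y v) = v" if "v \<in> free_space X" for v
  proof (rule poly_mapping_eqI)
    show "Poly_Mapping.lookup (sol_psi X S x (sol_psi X S y v)) z = Poly_Mapping.lookup v z" for z
      using that
      by (simp add: lookup_sol_psi X bij_f xy psi_closed gf_closed id eq free_space_iff[OF X])
  qed
  then have "compose (free_space X) (sol_psi X S x) (sol_psi X S y) = (\<lambda>v\<in>free_space X. v)"
    by (auto simp: compose_def)
  then show ?thesis
    using X xy by (simp add: GL_mult psi_GL) (simp add: GL_def BijGroup_def)
qed

text \<open>Replaces the representation picked by \<open>SOME\<close> with an explicit generating
  set; from here on \<open>structure_rep\<close> is no longer mentioned.\<close>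

lemma W_carrier:
  assumes "finite X"
  shows "carrier (W_group X S) = generate GLX (sol_psi X S ` X)"
proof -
  let ?R = "structure_relations X S"
  note R = structure_relations_carrier[OF sol]
  have G: "group (structure_group X S)"
    unfolding structure_group_def by (rule group_presented_group[OF R])
  interpret k: group_hom "structure_group X S" GLX "structure_rep X S"
    by (intro group_hom.intro group_hom_axioms.intro G group_GLX structure_rep(1) assms sol)
  have gen: "carrier (structure_group X S) = generate (structure_group X S) (pres_gen X ?R ` X)"
    unfolding structure_group_def by (rule presented_group_generate[OF R])
  have "pres_gen X ?R ` X \<subseteq> carrier (structure_group X S)"
    unfolding gen by (auto intro: generate.incl)
  from k.generate_img[OF this]
  have "structure_rep X S ` carrier (structure_group X S) =
      generate GLX (structure_rep X S ` pres_gen X ?R ` X)"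
    by (simp only: gen)
  also have "structure_rep X S ` pres_gen X ?R ` X = sol_psi X S ` X"
    by (auto simp: image_image structure_rep(2)[OF assms sol])
  finally show ?thesis by (simp add: W_group_def)
qed

lemma subgroup_W: "finite X \<Longrightarrow> subgroup (carrier (W_group X S)) GLX"
  unfolding W_carrier by (intro group.generate_is_subgroup group_GLX) (auto simp: psi_GL)

lemma W_group_eq: "W_group X S = GLX\<lparr>carrier := carrier (W_group X S)\<rparr>"
  by (simp add: W_group_def)

lemma group_W: "finite X \<Longrightarrow> group (W_group X S)"
  using subgroup.subgroup_is_group[OF subgroup_W group_GLX] by (simp flip: W_group_eq)

section \<open>Orbit of the all-ones vector: the lower bound\<close>

definition sign_vec :: "'a set \<Rightarrow> 'a \<Rightarrow>\<^sub>0 real" where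
  "sign_vec B = (\<Sum>y\<in>X. (if y \<in> B then - 1 else 1) *\<^sub>R basis_vec y)"

lemma sign_vec_closed: "sign_vec B \<in> free_space X"
  unfolding sign_vec_def by (rule comb_free_space)

lemma lookup_sign_vec:
  "finite X \<Longrightarrow> Poly_Mapping.lookup (sign_vec B) z = (if z \<in> X then if z \<in> B then - 1 else 1 else 0)"
  unfolding sign_vec_def by (rule lookup_comb)

lemma inj_sign_vec:
  assumes "finite X"
  shows "inj_on sign_vec (Pow X)"
proof (rule inj_onI)
  fix B D assume BD: "B \<in> Pow X" "D \<in> Pow X" and eq: "sign_vec B = sign_vec D"
  have "z \<in> B \<longleftrightarrow> z \<in> D" if "z \<in> X" for z
    using arg_cong[OF eq, of "\<lambda>v. Poly_Mapping.lookup v z"] that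
    by (simp add: lookup_sign_vec[OF assms] split: if_splits)
  then show "B = D" using BD by blast
qed

text \<open>Induction on the number of minus signs. A generator pulls coordinates back along its
  \<open>f\<close> and flips one sign; choosing it to flip a given \<open>y\<close> in
  \<open>B\<close> leaves a sign vector with one minus sign fewer to reach.\<close>

lemma sign_vec_orbit:
  assumes X: "finite X" and "B \<subseteq> X"
  shows "\<exists>T \<in> carrier (W_group X S). T (sign_vec {}) = sign_vec B"
  using \<open>B \<subseteq> X\<close>
proof (induction "card B" arbitrary: B)
  case 0
  then have "B = {}" using X finite_subset by fastforce
  moreover have "\<one>\<^bsub>GLX\<^esub> (sign_vec {}) = sign_vec {}"
    using sign_vec_closed by (simp add: GL_def BijGroup_def)
  ultimately show ?case using subgroup.one_closed[OF subgroup_W[OF X]] by blast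
next
  case (Suc n)
  have finB: "finite B" using Suc.prems X by (rule finite_subset)
  obtain y where y: "y \<in> B" using Suc.hyps(2) by fastforce
  then have yX: "y \<in> X" using Suc.prems by blast
  \<comment> \<open>Chosen so that \<open>sol_f S x y = x\<close>, which puts the sign flip of
    \<open>sol_psi X S x\<close> at coordinate \<open>y\<close>.\<close>
  define x where "x = \<gamma> y y"
  have x: "x \<in> X" using yX by (simp add: x_def)
  note fx = bij_betw_imp_inj_on[OF bij_f[OF x]]
  have fxy: "sol_f S x y = x" using frozen_\<gamma>[OF yX] by (simp add: S_eq x_def)
  let ?D = "sol_f S x ` (B - {y})"
  have sub: "B - {y} \<subseteq> X" using Suc.prems by blast
  have "card ?D = card (B - {y})" using fx sub by (intro card_image) (rule inj_on_subset)
  then have "n = card ?D" using Suc.hyps(2) y finB by simp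
  moreover have "?D \<subseteq> X" using sub x by (auto simp: gf_closed)
  ultimately obtain T where T: "T \<in> carrier (W_group X S)" "T (sign_vec {}) = sign_vec ?D"
    using Suc.hyps(1) by blast
  have mem: "sol_f S x z \<in> ?D \<longleftrightarrow> z \<in> B - {y}" and eq: "sol_f S x z = x \<longleftrightarrow> z = y" if "z \<in> X" for z
    using inj_on_image_mem_iff[OF fx that sub] inj_on_eq_iff[OF fx that yX] fxy by auto
  have "sol_psi X S x (sign_vec ?D) = sign_vec B"
  proof (rule poly_mapping_eqI)
    show "Poly_Mapping.lookup (sol_psi X S x (sign_vec ?D)) z = Poly_Mapping.lookup (sign_vec B) z" for z
    proof (cases "z \<in> X")
      case True
      have "Poly_Mapping.lookup (sol_psi X S x (sign_vec ?D)) z =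
          (if z = y then - 1 else 1) * (if z \<in> B - {y} then - 1 else 1)"
        by (simp only: lookup_sol_psi[OF X bij_f[OF x] sign_vec_closed] lookup_sign_vec[OF X]
            mem[OF True] eq[OF True] True gf_closed(2)[OF True x] if_True)
      also have "\<dots> = (if z \<in> B then - 1 else 1)" using y by auto
      finally show ?thesis by (simp only: lookup_sign_vec[OF X] True if_True)
    qed (simp add: lookup_sol_psi[OF X bij_f[OF x] sign_vec_closed] lookup_sign_vec[OF X])
  qed
  moreover have psi: "sol_psi X S x \<in> carrier (W_group X S)"
    using x by (auto simp: W_carrier[OF X] intro: generate.incl)
  moreover have "T \<in> carrier GLX" using subgroup.mem_carrier[OF subgroup_W[OF X] T(1)] .
  ultimately have "(sol_psi X S x \<otimes>\<^bsub>GLX\<^esub> T) (sign_vec {}) = sign_vec B"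
    using T(2) sign_vec_closed by (simp add: GL_mult psi_GL[OF X x] compose_def)
  then show ?case using subgroup.m_closed[OF subgroup_W[OF X] psi T(1)] by blast
qed

text \<open>Evaluation at the all-ones vector reaches every sign vector. Finiteness is assumed
  because \<open>card\<close> of an infinite set is 0; it will come from the presented
  group.\<close>

lemma card_W_ge:
  assumes X: "finite X" and fin: "finite (carrier (W_group X S))"
  shows "2 ^ card X \<le> card (carrier (W_group X S))"
proof -
  have "sign_vec ` Pow X \<subseteq> (\<lambda>T. T (sign_vec {})) ` carrier (W_group X S)"
  proof (rule image_subsetI)
    fix B assume "B \<in> Pow X"
    then obtain T where "T \<in> carrier (W_group X S)" "T (sign_vec {}) = sign_vec B"
      using sign_vec_orbit[OF X] by blast
    then show "sign_vec B \<in> (\<lambda>T. T (sign_vec {})) ` carrier (W_group X S)"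
      by (metis (no_types, lifting) image_eqI)
  qed
  then have "card (sign_vec ` Pow X) \<le> card (carrier (W_group X S))"
    by (rule surj_card_le[OF fin])
  then show ?thesis using X by (simp add: card_image[OF inj_sign_vec] card_Pow)
qed

end

section \<open>Comparison of the presented group with W\<close>

theorem corollary3p10:
  fixes X :: "'a set" and S :: "'a \<times> 'a \<Rightarrow> 'a \<times> 'a" and n :: nat
  assumes "finite X" and "card X = n"
    and "nondegenerate_symmetric_solution X S"
    and "property_C X S"
  shows "has_presentation (W_group X S) (sol_psi X S ` X)
      ({(free_gen (sol_psi X S x) \<otimes>\<^bsub>free_group (sol_psi X S ` X)\<^esub> free_gen (sol_psi X S y),
         free_gen (sol_psi X S z) \<otimes>\<^bsub>free_group (sol_psi X S ` X)\<^esub> free_gen (sol_psi X S t)) | x y z t.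
         x \<in> X \<and> y \<in> X \<and> S (x, y) = (z, t) \<and> (z, t) \<noteq> (x, y)} \<union>
       {(free_gen (sol_psi X S x) \<otimes>\<^bsub>free_group (sol_psi X S ` X)\<^esub> free_gen (sol_psi X S y),
         \<one>\<^bsub>free_group (sol_psi X S ` X)\<^esub>) | x y.
         x \<in> X \<and> y \<in> X \<and> S (x, y) = (x, y)})
    \<and> (group (W_group X S) \<and> finite (carrier (W_group X S)) \<and> order (W_group X S) = 2 ^ n)"
proof -
  interpret symmetric_solution X S by unfold_locales (rule assms(3))
  note X = assms(1) and C = assms(4)
  define A where "A = sol_psi X S ` X"
  define R where "R = {(free_gen (sol_psi X S x) \<otimes>\<^bsub>free_group A\<^esub> free_gen (sol_psi X S y),
         free_gen (sol_psi X S z) \<otimes>\<^bsub>free_group A\<^esub> free_gen (sol_psi X S t)) | x y z t.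
         x \<in> X \<and> y \<in> X \<and> S (x, y) = (z, t) \<and> (z, t) \<noteq> (x, y)} \<union>
       {(free_gen (sol_psi X S x) \<otimes>\<^bsub>free_group A\<^esub> free_gen (sol_psi X S y),
         \<one>\<^bsub>free_group A\<^esub>) | x y. x \<in> X \<and> y \<in> X \<and> S (x, y) = (x, y)}"
  let ?P = "presented_group A R"
  interpret F: group "free_group A" by (rule group_free_group)
  interpret L: group GLX by (rule group_GLX)
  have gen_F: "free_gen (sol_psi X S x) \<in> carrier (free_group A)" if "x \<in> X" for x
    using that by (simp add: A_def free_gen_carrier)
  have Rc: "R \<subseteq> carrier (free_group A) \<times> carrier (free_group A)"
    by (auto simp: R_def gen_F S_eq gf_closed)
  interpret P: group_hom "free_group A" ?P
      "\<lambda>w. normal_closure (free_group A) (relators A R) #>\<^bsub>free_group A\<^esub> w"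
    by (rule presented_group_proj[OF Rc])
  note relP = presented_group_relation[OF Rc]
  \<comment> \<open>Indexing by \<open>X\<close> through \<open>sol_psi\<close> lets the counting
    argument apply without asking whether distinct elements of \<open>X\<close> give distinct
    generators.\<close>
  interpret Q: solution_quotient X S ?P "\<lambda>x. pres_gen A R (sol_psi X S x)"
  proof unfold_locales
    show "(\<lambda>x. pres_gen A R (sol_psi X S x)) \<in> X \<rightarrow> carrier ?P"
      unfolding pres_gen_def using gen_F P.hom_closed by blast
  next
    fix x y assume xy: "x \<in> X" "y \<in> X" "S (x, y) \<noteq> (x, y)"
    then have "(free_gen (sol_psi X S x) \<otimes>\<^bsub>free_group A\<^esub> free_gen (sol_psi X S y),
         free_gen (sol_psi X S (sol_g S x y)) \<otimes>\<^bsub>free_group A\<^esub> free_gen (sol_psi X S (sol_f S y x))) \<in> R"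
      unfolding R_def
      by (intro UnI1 CollectI exI[of _ x] exI[of _ y] exI[of _ "sol_g S x y"] exI[of _ "sol_f S y x"])
         (simp add: S_eq)
    from relP[OF this] show "pres_gen A R (sol_psi X S x) \<otimes>\<^bsub>?P\<^esub> pres_gen A R (sol_psi X S y) =
        pres_gen A R (sol_psi X S (sol_g S x y)) \<otimes>\<^bsub>?P\<^esub> pres_gen A R (sol_psi X S (sol_f S y x))"
      using xy by (simp add: pres_gen_def P.hom_mult gen_F gf_closed)
  next
    fix x y assume xy: "x \<in> X" "y \<in> X" "S (x, y) = (x, y)"
    then have "(free_gen (sol_psi X S x) \<otimes>\<^bsub>free_group A\<^esub> free_gen (sol_psi X S y), \<one>\<^bsub>free_group A\<^esub>) \<in> R"
      unfolding R_def by blast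
    from relP[OF this] show
      "pres_gen A R (sol_psi X S x) \<otimes>\<^bsub>?P\<^esub> pres_gen A R (sol_psi X S y) = \<one>\<^bsub>?P\<^esub>"
      using xy P.hom_one by (simp add: pres_gen_def P.hom_mult gen_F)
  qed (rule C)
  have genP: "carrier ?P = generate ?P (pres_gen A R ` A)" by (rule presented_group_generate[OF Rc])
  then have "carrier ?P = generate ?P ((\<lambda>x. pres_gen A R (sol_psi X S x)) ` X)"
    by (simp add: A_def image_image)
  note cardP = Q.card_le[OF X this]
  have idA: "(\<lambda>a. a) \<in> A \<rightarrow> carrier GLX" by (auto simp: A_def psi_GL X)
  have ev: "word_eval GLX (\<lambda>a. a)
      (free_gen (sol_psi X S x) \<otimes>\<^bsub>free_group A\<^esub> free_gen (sol_psi X S y)) =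
      sol_psi X S x \<otimes>\<^bsub>GLX\<^esub> sol_psi X S y" if "x \<in> X" "y \<in> X" for x y
    using hom_mult[OF free_group_lift(1)[OF group_GLX idA] gen_F gen_F] that
    by (simp add: free_group_lift(2)[OF group_GLX idA] A_def)
  have ev1: "word_eval GLX (\<lambda>a. a) \<one>\<^bsub>free_group A\<^esub> = \<one>\<^bsub>GLX\<^esub>"
    by (intro hom_one[OF free_group_lift(1)[OF group_GLX idA]] group_free_group group_GLX)
  \<comment> \<open>Universal property: the linear maps satisfy the relations, by the braid equation
    for moved pairs and by Property C for frozen ones.\<close>
  have "\<exists>k \<in> hom ?P GLX. \<forall>a\<in>A. k (pres_gen A R a) = a"
  proof (rule presented_group_lift[OF group_GLX idA Rc])
    fix u v assume "(u, v) \<in> R"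
    then consider
        (move) x y z t where "x \<in> X" "y \<in> X" "S (x, y) = (z, t)"
          "u = free_gen (sol_psi X S x) \<otimes>\<^bsub>free_group A\<^esub> free_gen (sol_psi X S y)"
          "v = free_gen (sol_psi X S z) \<otimes>\<^bsub>free_group A\<^esub> free_gen (sol_psi X S t)"
      | (frozen) x y where "x \<in> X" "y \<in> X" "S (x, y) = (x, y)"
          "u = free_gen (sol_psi X S x) \<otimes>\<^bsub>free_group A\<^esub> free_gen (sol_psi X S y)"
          "v = \<one>\<^bsub>free_group A\<^esub>"
      unfolding R_def by blast
    then show "word_eval GLX (\<lambda>a. a) u = word_eval GLX (\<lambda>a. a) v"
    proof cases
      case move
      then have "z = sol_g S x y" "t = sol_f S y x" by (simp_all add: S_eq)
      then show ?thesis
        using move(1,2,4,5) sol_psi_relation[OF X sol move(1,2)] gf_closed[OF move(1,2)]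
        by (simp only: ev)
    next
      case frozen
      then show ?thesis by (simp only: ev ev1 psi_frozen[OF X C])
    qed
  qed
  then obtain k where k: "k \<in> hom ?P GLX" "\<And>a. a \<in> A \<Longrightarrow> k (pres_gen A R a) = a" by blast
  interpret k: group_hom ?P GLX k
    using k(1) by unfold_locales
  have "pres_gen A R ` A \<subseteq> carrier ?P" unfolding genP by (auto intro: generate.incl)
  from k.generate_img[OF this] have "k ` carrier ?P = generate GLX (k ` pres_gen A R ` A)"
    by (simp only: genP)
  also have "k ` pres_gen A R ` A = A" using k(2) by (auto simp: image_image)
  finally have img: "k ` carrier ?P = carrier (W_group X S)"
    by (simp add: W_carrier[OF X] A_def)
  have fin: "finite (carrier (W_group X S))" using cardP(1) by (simp flip: img)
  have "card (carrier (W_group X S)) \<le> card (carrier ?P)"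
    using card_image_le[OF cardP(1), of k] by (simp add: img)
  \<comment> \<open>The bounds close up: \<open>2 ^ n\<close> is at most the size of W, which is at
    most that of the presented group, which is at most \<open>2 ^ n\<close>.\<close>
  then have card: "card (carrier (W_group X S)) = 2 ^ n" "card (carrier ?P) = 2 ^ n"
    using cardP(2) card_W_ge[OF X fin] assms(2) by auto
  \<comment> \<open>A map of a finite set onto a set of the same size is injective.\<close>
  have "inj_on k (carrier ?P)"
    using cardP(1) by (rule eq_card_imp_inj_on) (simp add: img card)
  moreover have "k \<in> hom ?P (W_group X S)"
    using k(1) img by (subst W_group_eq) (auto simp: hom_def)
  ultimately have "k \<in> iso ?P (W_group X S)"
    by (simp add: iso_def bij_betw_def img)
  moreover have "A \<subseteq> carrier (W_group X S)"
    by (auto simp: W_carrier[OF X] A_def intro: generate.incl)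
  ultimately have "has_presentation (W_group X S) A R"
    using k(2) group_W[OF X] unfolding has_presentation_def by blast
  then show ?thesis
    using group_W[OF X] fin card(1) unfolding R_def A_def order_def by blast
qed

end
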